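(* Let $n$ be a positive integer, $0\le s\le n$, and $A\in\omega_n^s$. If $A$ has two distinct rows whose sums both lie strictly between $0$ and $1$, or two distinct columns whose sums both lie strictly between $0$ and $1$, then $A$ is not an extreme point of $\omega_n^s$.
   Context: $\omega_n$ is the set of $n\times n$ nonnegative real matrices with all row and column sums at most $1$; $\omega_n^s$ is the set of $A\in\omega_n$ whose entries sum to $s$. An extreme point of a convex set $C$ is a point of $C$ that is not of the form $\lambda y+(1-\lambda)z$ with $y,z\in C$, $y\ne z$, $0<\lambda<1$. *)

theory Defs
  imports "HOL-Analysis.Analysis"
begin

definition row_sum :: "real ^ 'n ^ 'm \<Rightarrow> 'm \<Rightarrow> real" where
  "row_sum A i = (\<Sum>j\<in>UNIV. A $ i $ j)"

definition col_sum :: "real ^ 'n ^ 'm \<Rightarrow> 'n \<Rightarrow> real" where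
  "col_sum A j = (\<Sum>i\<in>UNIV. A $ i $ j)"

definition doubly_substochastic :: "(real ^ 'n ^ 'n) set" where
  "doubly_substochastic =
     {A. (\<forall>i j. 0 \<le> A $ i $ j) \<and> (\<forall>i. row_sum A i \<le> 1) \<and> (\<forall>j. col_sum A j \<le> 1)}"

definition doubly_substochastic_sum :: "real \<Rightarrow> (real ^ 'n ^ 'n) set" where
  "doubly_substochastic_sum s =
     {A \<in> doubly_substochastic. (\<Sum>i\<in>UNIV. \<Sum>j\<in>UNIV. A $ i $ j) = s}"

end

theory Submission
  imports Defs
begin

text \<open>
  Border \<open>A\<close> by its row and column slacks (with corner entry 0): all margins of the bordered matrix
  except those of the border row and the border column are 1, so the bipartite graph of its entries
  in \<open>(0,1)\<close> has no vertex of degree 1 among ordinary rows and columns. Two rows with sums in \<open>(0,1)\<close>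
  give the border column degree at least 2, so only the border row can be a leaf. Counting degrees,
  the graph has at least as many edges as non-isolated vertices, while its incidence vectors span
  a space of smaller dimension (row margins and column margins have the same total). Hence some
  nonzero weighting of the edges has all margins zero, and \<open>A\<close> can be moved both ways along it.
\<close>

section \<open>Degree counts in a finite bipartite graph\<close>

lemma card_eq_sum_card_rows:
  fixes F :: "('r::finite \<times> 'c::finite) set"
  shows "card F = (\<Sum>r\<in>fst ` F. card {c. (r, c) \<in> F})"
proof -
  have "F = Sigma (fst ` F) (\<lambda>r. {c. (r, c) \<in> F})"
    by force
  then have "card F = card (Sigma (fst ` F) (\<lambda>r. {c. (r, c) \<in> F}))"
    by (rule arg_cong)
  also have "\<dots> = (\<Sum>r\<in>fst ` F. card {c. (r, c) \<in> F})"
    by (rule card_SigmaI) auto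
  finally show ?thesis .
qed

text \<open>Each row meeting \<open>F\<close> has degree at least 2, except that \<open>r0\<close>
  may be a leaf; the degrees add up to \<open>card F\<close>, and the possible deficit at
  \<open>r0\<close> costs the 1 on the right.\<close>

lemma two_card_rows_le:
  fixes F :: "('r::finite \<times> 'c::finite) set"
  assumes "\<And>r. r \<noteq> r0 \<Longrightarrow> card {c. (r, c) \<in> F} \<noteq> 1"
  shows "2 * card (fst ` F) \<le> card F + 1"
proof -
  have pos: "card {c. (r, c) \<in> F} \<noteq> 0" if "r \<in> fst ` F" for r
    using that by auto
  have "(\<Sum>r\<in>fst ` F. 2) \<le> (\<Sum>r\<in>fst ` F. card {c. (r, c) \<in> F} + of_bool (r = r0))"
  proof (rule sum_mono)
    fix r assume "r \<in> fst ` F"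
    note nonzero = pos[OF this]
    define d where "d = card {c. (r, c) \<in> F}"
    have "d \<noteq> 0" "r \<noteq> r0 \<Longrightarrow> d \<noteq> 1"
      unfolding d_def by (fact nonzero, erule assms)
    then have "2 \<le> d + of_bool (r = r0)"
      by (cases "r = r0") auto
    then show "2 \<le> card {c. (r, c) \<in> F} + of_bool (r = r0)"
      by (simp only: d_def)
  qed
  also have "\<dots> = card F + (\<Sum>r\<in>fst ` F. of_bool (r = r0))"
    by (simp add: sum.distrib card_eq_sum_card_rows[symmetric])
  also have "(\<Sum>r\<in>fst ` F. of_bool (r = r0)) \<le> (1::nat)"
    by (simp add: of_bool_def)
  finally show ?thesis by simp
qed

lemma two_card_cols_le:
  fixes F :: "('r::finite \<times> 'c::finite) set"
  assumes "\<And>c. card {r. (r, c) \<in> F} \<noteq> 1"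
  shows "2 * card (snd ` F) \<le> card F"
proof -
  \<comment> \<open>The converse relation exchanges rows and columns without changing the number of
    edges.\<close>
  have "F\<inverse> = prod.swap ` F" by auto
  then have F': "card (F\<inverse>) = card F" "fst ` (F\<inverse>) = snd ` F"
    by (force simp: card_image)+
  have "(\<Sum>c\<in>fst ` (F\<inverse>). 2) \<le> (\<Sum>c\<in>fst ` (F\<inverse>). card {r. (c, r) \<in> F\<inverse>})"
  proof (rule sum_mono)
    fix c assume "c \<in> fst ` (F\<inverse>)"
    then have "card {r. (r, c) \<in> F} \<noteq> 0" by auto
    then show "2 \<le> card {r. (c, r) \<in> F\<inverse>}"
      using assms[of c] unfolding converse_iff by linarith
  qed
  then show ?thesis
    using card_eq_sum_card_rows[of "F\<inverse>"] F' by simp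
qed

section \<open>Linear dependence of incidence vectors\<close>

lemma ex_nonzero_weighting_zero_margins:
  fixes F :: "('r::finite \<times> 'c::finite) set"
  assumes rows: "\<And>r. r \<noteq> r0 \<Longrightarrow> card {c. (r, c) \<in> F} \<noteq> 1"
    and cols: "\<And>c. card {r. (r, c) \<in> F} \<noteq> 1"
    and ne: "F \<noteq> {}"
  obtains E :: "'r \<times> 'c \<Rightarrow> real" where "\<exists>p. E p \<noteq> 0" "\<And>p. p \<notin> F \<Longrightarrow> E p = 0"
    "\<And>r. (\<Sum>c\<in>UNIV. E (r, c)) = 0" "\<And>c. (\<Sum>r\<in>UNIV. E (r, c)) = 0"
proof -
  \<comment> \<open>The margin at \<open>c0\<close> follows from the others, so its coordinate is
    blanked out in \<open>v\<close>. Taking \<open>c0\<close> non-isolated makes this lower the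
    vertex count by one.\<close>
  obtain c0 where c0: "c0 \<in> snd ` F" using ne by auto
  define v :: "'r \<times> 'c \<Rightarrow> real ^ ('r + 'c)" where
    "v p = (\<chi> x. case x of Inl r \<Rightarrow> of_bool (r = fst p) | Inr c \<Rightarrow> of_bool (c = snd p \<and> c \<noteq> c0))" for p
  have v_Inl: "v p $ Inl r = of_bool (r = fst p)"
    and v_Inr: "v p $ Inr c = of_bool (c = snd p \<and> c \<noteq> c0)" for p r c
    by (simp_all add: v_def)
  have inj: "inj_on v F"
  proof (rule inj_onI)
    fix p q assume eq: "v p = v q"
    have "fst p = fst q"
      using arg_cong[OF eq, of "\<lambda>w. w $ Inl (fst p)"] by (simp add: v_Inl split: if_splits)
    \<comment> \<open>Of two different columns at most one is \<open>c0\<close>, so one of these two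
      coordinates separates them.\<close>
    moreover have "snd p = snd q"
      using arg_cong[OF eq, of "\<lambda>w. w $ Inr (snd p)"] arg_cong[OF eq, of "\<lambda>w. w $ Inr (snd q)"]
      by (auto simp: v_Inr of_bool_def split: if_splits)
    ultimately show "p = q" by (simp add: prod_eq_iff)
  qed
  \<comment> \<open>Unit vectors of the non-isolated vertices other than \<open>c0\<close>; they
    span every incidence vector of an edge.\<close>
  define T :: "(real ^ ('r + 'c)) set" where
    "T = (\<lambda>r. axis (Inl r) 1) ` fst ` F \<union> (\<lambda>c. axis (Inr c) 1) ` (snd ` F - {c0})"
  have "card T \<le> card (fst ` F) + card (snd ` F - {c0})"
    unfolding T_def by (rule card_Un_le[THEN order_trans]) (intro add_mono card_image_le, auto)
  also have "\<dots> < card (fst ` F) + card (snd ` F)"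
    using c0 by (intro add_strict_left_mono psubset_card_mono) auto
  \<comment> \<open>Adding the two degree counts bounds twice the number of vertices by
    \<open>2 * card F + 1\<close>; parity removes the 1.\<close>
  also have "\<dots> \<le> card F"
    using two_card_rows_le[of r0 F] two_card_cols_le[of F] rows cols by force
  finally have card_T: "card T < card (v ` F)"
    by (simp add: card_image[OF inj])
  have "v ` F \<subseteq> span T"
  proof
    fix w assume "w \<in> v ` F"
    then obtain p where p: "p \<in> F" "w = v p" by auto
    have "w = axis (Inl (fst p)) 1 + (if snd p = c0 then 0 else axis (Inr (snd p)) 1)"
      unfolding p(2) vec_eq_iff
    proof
      fix x show "v p $ x =
        (axis (Inl (fst p)) 1 + (if snd p = c0 then 0 else axis (Inr (snd p)) 1)) $ x"
        by (cases x) (auto simp: v_Inl v_Inr axis_def)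
    qed
    also have "\<dots> \<in> span T"
      using p(1) by (intro span_add) (auto simp: T_def span_zero intro!: span_base)
    finally show "w \<in> span T" .
  qed
  then have "dependent (v ` F)"
    using independent_span_bound[of T "v ` F"] card_T by (force simp: T_def)
  then obtain u where u: "\<exists>w\<in>v ` F. u w \<noteq> 0" "(\<Sum>w\<in>v ` F. u w *\<^sub>R w) = 0"
    by (auto simp: dependent_finite)
  \<comment> \<open>Since \<open>v\<close> is injective on \<open>F\<close>, coefficients of vectors
    can be read as weights of edges.\<close>
  define E where "E p = (if p \<in> F then u (v p) else 0)" for p
  have "(\<Sum>p\<in>UNIV. E p *\<^sub>R v p) = (\<Sum>p\<in>F. u (v p) *\<^sub>R v p)"
    by (rule sum.mono_neutral_cong_right) (auto simp: E_def)
  also have "\<dots> = 0"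
    using u(2) by (simp add: sum.reindex[OF inj])
  finally have E0: "(\<Sum>p\<in>UNIV. E p *\<^sub>R v p) = 0" .
  have comp: "(\<Sum>r\<in>UNIV. \<Sum>c\<in>UNIV. E (r, c) * v (r, c) $ x) = 0" for x
  proof -
    have "(\<Sum>r\<in>UNIV. \<Sum>c\<in>UNIV. E (r, c) * v (r, c) $ x) = (\<Sum>p\<in>UNIV. E p *\<^sub>R v p) $ x"
      by (simp add: sum.cartesian_product case_prod_beta)
    then show ?thesis using E0 by simp
  qed
  have row0: "(\<Sum>c\<in>UNIV. E (r, c)) = 0" for r
  proof -
    have "(\<Sum>a\<in>UNIV. \<Sum>c\<in>UNIV. E (a, c) * v (a, c) $ Inl r)
        = (\<Sum>a\<in>UNIV. if a = r then \<Sum>c\<in>UNIV. E (a, c) else 0)"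
      by (intro sum.cong) (auto simp: v_Inl)
    then show ?thesis using comp[of "Inl r"] by simp
  qed
  have col0': "(\<Sum>r\<in>UNIV. E (r, c)) = 0" if "c \<noteq> c0" for c
  proof -
    have "(\<Sum>r\<in>UNIV. \<Sum>b\<in>UNIV. E (r, b) * v (r, b) $ Inr c)
        = (\<Sum>r\<in>UNIV. \<Sum>b\<in>UNIV. if b = c then E (r, b) else 0)"
      using that by (intro sum.cong) (auto simp: v_Inr)
    then show ?thesis using comp[of "Inr c"] by simp
  qed
  \<comment> \<open>The blanked column is recovered from the total weight, which is 0 by the row
    margins.\<close>
  have "(\<Sum>r\<in>UNIV. E (r, c0)) = (\<Sum>c\<in>UNIV. \<Sum>r\<in>UNIV. E (r, c))"
    by (subst sum.remove[of _ c0]) (auto simp: col0')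
  also have "\<dots> = 0"
    by (subst sum.swap) (simp add: row0)
  finally have col0: "(\<Sum>r\<in>UNIV. E (r, c)) = 0" for c
    using col0' by (cases "c = c0") auto
  show thesis
    using u(1) by (intro that[of E] row0 col0) (auto simp: E_def)
qed

section \<open>Fractional entries, step size and segments\<close>

lemma card_fractional_neq_1:
  fixes f :: "'a::finite \<Rightarrow> real"
  assumes nonneg: "\<And>x. 0 \<le> f x" and sum1: "(\<Sum>x\<in>UNIV. f x) = 1"
  shows "card {x. 0 < f x \<and> f x < 1} \<noteq> 1"
proof
  assume "card {x. 0 < f x \<and> f x < 1} = 1"
  then obtain a where a: "{x. 0 < f x \<and> f x < 1} = {a}"
    by (auto simp: card_1_singleton_iff)
  have le1: "f x \<le> 1" for x
    using member_le_sum[of x UNIV f] nonneg sum1 by simp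
  \<comment> \<open>Every value except that at \<open>a\<close> is 0 or 1, which forces
    \<open>f a\<close> to be an integer too.\<close>
  have "f x \<in> \<int>" if "x \<noteq> a" for x
  proof -
    have "\<not> (0 < f x \<and> f x < 1)" using a that by blast
    then have "f x = 0 \<or> f x = 1" using nonneg[of x] le1[of x] by linarith
    then show ?thesis by auto
  qed
  then have "(\<Sum>x\<in>UNIV - {a}. f x) \<in> \<int>"
    by (intro Ints_sum) auto
  moreover have "f a = 1 - (\<Sum>x\<in>UNIV - {a}. f x)"
    using sum1 by (simp add: sum.remove[of UNIV a])
  ultimately have "f a \<in> \<int>" by simp
  then obtain k :: int where "f a = of_int k" by (auto elim: Ints_cases)
  moreover have "0 < f a" "f a < 1" using a by blast+
  ultimately show False by simp
qed

lemma ex_pos_scaling_le: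
  fixes E B :: "'a::finite \<Rightarrow> real"
  assumes "\<And>p. 0 \<le> B p" "\<And>p. E p \<noteq> 0 \<Longrightarrow> 0 < B p"
  obtains e where "0 < e" "\<And>p. e * \<bar>E p\<bar> \<le> B p"
proof -
  \<comment> \<open>The inserted 1 keeps the set nonempty when \<open>E\<close> vanishes
    everywhere.\<close>
  define e where "e = Min (insert 1 ((\<lambda>p. B p / \<bar>E p\<bar>) ` {p. E p \<noteq> 0}))"
  have "0 < e"
    using assms(2) by (auto simp: e_def)
  moreover have "e * \<bar>E p\<bar> \<le> B p" for p
  proof (cases "E p = 0")
    case False
    then have "e \<le> B p / \<bar>E p\<bar>"
      by (auto simp: e_def intro!: Min_le)
    then show ?thesis using False by (simp add: pos_le_divide_eq)
  qed (use assms(1) in simp)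
  ultimately show thesis by (rule that)
qed

lemma not_extreme_point_if_segment:
  fixes x y :: "'a::real_vector"
  assumes "y \<noteq> 0" "x + y \<in> S" "x - y \<in> S"
  shows "\<not> x extreme_point_of S"
proof
  assume ext: "x extreme_point_of S"
  have "x + y \<noteq> x - y"
  proof
    assume "x + y = x - y"
    then have "2 *\<^sub>R y = 0" by (simp add: scaleR_2 algebra_simps)
    then show False using assms(1) by simp
  qed
  moreover have "midpoint (x + y) (x - y) = x"
    by (simp add: midpoint_def scaleR_2[symmetric])
  ultimately have "x \<in> open_segment (x + y) (x - y)"
    using midpoint_in_open_segment by metis
  then show False
    using ext assms(2,3) by (auto simp: extreme_point_of_def)
qed

section \<open>The bordered matrix and its perturbation\<close>

lemma sum_UNIV_option:
  fixes f :: "'a::finite option \<Rightarrow> 'b::comm_monoid_add"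
  shows "(\<Sum>x\<in>UNIV. f x) = f None + (\<Sum>i\<in>UNIV. f (Some i))"
  by (simp add: UNIV_option_conv sum.reindex)

text \<open>The index \<open>None\<close> is the border. The corner 0 is never fractional, so
  weightings of the fractional entries vanish there; this is what preserves the total
  \<open>s\<close>.\<close>

fun bordered :: "real ^ 'n ^ 'n \<Rightarrow> 'n option \<times> 'n option \<Rightarrow> real" where
  "bordered A (Some i, Some j) = A $ i $ j"
| "bordered A (Some i, None) = 1 - row_sum A i"
| "bordered A (None, Some j) = 1 - col_sum A j"
| "bordered A (None, None) = 0"

lemma bordered_row_sum: "(\<Sum>b\<in>UNIV. bordered A (Some i, b)) = 1"
  by (simp add: sum_UNIV_option row_sum_def)

lemma bordered_col_sum: "(\<Sum>a\<in>UNIV. bordered A (a, Some j)) = 1"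
  by (simp add: sum_UNIV_option col_sum_def)

lemma doubly_substochastic_iff_bordered_nonneg:
  "A \<in> doubly_substochastic \<longleftrightarrow> (\<forall>p. 0 \<le> bordered A p)"
  by (auto simp: doubly_substochastic_def split_option_all)

lemma not_extreme_point_if_two_fractional_rows:
  fixes A :: "real ^ 'n ^ 'n"
  assumes A: "A \<in> doubly_substochastic_sum s" and "i \<noteq> k"
    and i: "0 < row_sum A i" "row_sum A i < 1" and k: "0 < row_sum A k" "row_sum A k < 1"
  shows "\<not> A extreme_point_of doubly_substochastic_sum s"
proof -
  let ?B = "bordered A"
  have nonneg: "0 \<le> ?B p" for p
    using A by (simp add: doubly_substochastic_sum_def doubly_substochastic_iff_bordered_nonneg
        del: split_paired_All)
  define F where "F = {p. 0 < ?B p \<and> ?B p < 1}"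
  have ik: "(Some i, None) \<in> F" "(Some k, None) \<in> F"
    using i k by (auto simp: F_def)
  have rows: "card {b. (a, b) \<in> F} \<noteq> 1" if "a \<noteq> None" for a
    using that card_fractional_neq_1[of "\<lambda>b. ?B (a, b)"] nonneg bordered_row_sum[of A]
    by (auto simp: F_def)
  have cols: "card {a. (a, b) \<in> F} \<noteq> 1" for b
  proof (cases b)
    \<comment> \<open>The margin of the border column need not be 1; here the slacks of rows
      \<open>i\<close> and \<open>k\<close> give two edges.\<close>
    case None
    have "Some i = Some k" if "{a. (a, None) \<in> F} = {x}" for x
      using ik that by (metis mem_Collect_eq singletonD)
    then show ?thesis using None \<open>i \<noteq> k\<close> by (auto simp: card_1_singleton_iff)
  next
    case (Some j)
    then show ?thesis
      using card_fractional_neq_1[of "\<lambda>a. ?B (a, b)"] nonneg bordered_col_sum[of A j]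
      by (auto simp: F_def)
  qed
  \<comment> \<open>The border row, whose margin is not controlled, takes the role of the exempt row
    \<open>r0\<close>.\<close>
  obtain E :: "'n option \<times> 'n option \<Rightarrow> real" where
    E: "\<exists>p. E p \<noteq> 0" "\<And>p. p \<notin> F \<Longrightarrow> E p = 0"
       "\<And>a. (\<Sum>b\<in>UNIV. E (a, b)) = 0" "\<And>b. (\<Sum>a\<in>UNIV. E (a, b)) = 0"
    using ex_nonzero_weighting_zero_margins[of None F] rows cols ik by blast
  have E_pos: "0 < ?B p" if "E p \<noteq> 0" for p
    using E(2)[of p] that by (auto simp: F_def)
  then obtain e where e: "0 < e" "\<And>p. e * \<bar>E p\<bar> \<le> ?B p"
    using ex_pos_scaling_le[of ?B E] nonneg by blast
  define D :: "real ^ 'n ^ 'n" where "D = (\<chi> i j. e * E (Some i, Some j))"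
  have E_corner: "E (None, None) = 0"
    using E_pos[of "(None, None)"] by auto
  have E_row: "(\<Sum>j\<in>UNIV. E (Some i, Some j)) = - E (Some i, None)" for i
    using E(3)[of "Some i"] by (simp add: sum_UNIV_option)
  have E_col: "(\<Sum>i\<in>UNIV. E (Some i, Some j)) = - E (None, Some j)" for j
    using E(4)[of "Some j"] by (simp add: sum_UNIV_option)
  have row_D: "row_sum D i = - e * E (Some i, None)" for i
    by (simp add: row_sum_def D_def sum_distrib_left[symmetric] E_row)
  have col_D: "col_sum D j = - e * E (None, Some j)" for j
    by (simp add: col_sum_def D_def sum_distrib_left[symmetric] E_col)
  \<comment> \<open>The total of \<open>D\<close> is \<open>- e\<close> times the margin of the
    border column of \<open>E\<close>, because the corner contributes 0.\<close>
  have tot_D: "(\<Sum>i\<in>UNIV. row_sum D i) = 0"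
    using E(4)[of None] E_corner
    by (simp add: row_D sum_negf sum_distrib_left[symmetric] sum_UNIV_option)
  \<comment> \<open>The inner block of \<open>E\<close> determines its border through the zero
    margins, so it cannot vanish alone.\<close>
  have "D \<noteq> 0"
  proof
    assume "D = 0"
    then have "E (Some i, Some j) = 0" for i j
      using e(1) by (auto simp: D_def vec_eq_iff)
    moreover from this have "E (Some i, None) = 0" "E (None, Some j) = 0" for i j
      using E_row[of i] E_col[of j] by simp_all
    ultimately have "E p = 0" for p
      using E_corner by (metis option.exhaust surj_pair)
    then show False using E(1) by blast
  qed
  have move: "A + t *\<^sub>R D \<in> doubly_substochastic_sum s" if t: "\<bar>t\<bar> = 1" for t
  proof -
    have row: "row_sum (A + t *\<^sub>R D) i = row_sum A i + t * row_sum D i" for i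
      by (simp add: row_sum_def sum.distrib sum_distrib_left)
    have col: "col_sum (A + t *\<^sub>R D) j = col_sum A j + t * col_sum D j" for j
      by (simp add: col_sum_def sum.distrib sum_distrib_left)
    \<comment> \<open>The slacks change exactly by the border entries of the scaled weighting, so
      the choice of \<open>e\<close> keeps all constraints at once.\<close>
    have "bordered (A + t *\<^sub>R D) p = ?B p + t * (e * E p)" for p
      using E_corner
      by (cases p, cases "fst p"; cases "snd p")
        (auto simp: row col row_D col_D, auto simp: D_def)
    moreover have "\<bar>t * (e * E p)\<bar> \<le> ?B p" for p
      using e t by (simp add: abs_mult)
    ultimately have "0 \<le> bordered (A + t *\<^sub>R D) p" for p
      by (smt (verit))
    moreover have "(\<Sum>i\<in>UNIV. row_sum (A + t *\<^sub>R D) i) = (\<Sum>i\<in>UNIV. row_sum A i)"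
      by (simp add: row sum.distrib sum_distrib_left[symmetric] tot_D)
    ultimately show ?thesis
      using A by (simp add: doubly_substochastic_sum_def row_sum_def
          doubly_substochastic_iff_bordered_nonneg)
  qed
  show ?thesis
    using not_extreme_point_if_segment[OF \<open>D \<noteq> 0\<close>] move[of 1] move[of "-1"] by simp
qed

section \<open>Reduction of columns to rows by transposition\<close>

lemma transpose_in_doubly_substochastic_sum:
  "transpose A \<in> doubly_substochastic_sum s \<longleftrightarrow> A \<in> doubly_substochastic_sum s"
proof -
  have "(\<Sum>i\<in>UNIV. \<Sum>j\<in>UNIV. A $ j $ i) = (\<Sum>i\<in>UNIV. \<Sum>j\<in>UNIV. A $ i $ j)"
    by (rule sum.swap)
  then show ?thesis
    by (auto simp: doubly_substochastic_sum_def doubly_substochastic_def row_sum_def col_sum_def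
        transpose_def)
qed

text \<open>Extreme points are singleton faces, and transposition is an injective linear map
  carrying the set onto itself, hence faces to faces.\<close>

lemma extreme_point_of_doubly_substochastic_sum_transpose:
  fixes A :: "real ^ 'n ^ 'n"
  shows "transpose A extreme_point_of doubly_substochastic_sum s \<longleftrightarrow>
    A extreme_point_of doubly_substochastic_sum s"
proof -
  let ?t = "transpose :: real ^ 'n ^ 'n \<Rightarrow> real ^ 'n ^ 'n"
  have "linear ?t"
    by (rule linearI) (simp_all add: transpose_def vec_eq_iff)
  moreover have "inj ?t"
    by (metis injI transpose_transpose)
  moreover have "?t ` doubly_substochastic_sum s = doubly_substochastic_sum s"
  proof (intro equalityI subsetI)
    fix B :: "real ^ 'n ^ 'n" assume "B \<in> doubly_substochastic_sum s"
    then have "?t B \<in> doubly_substochastic_sum s"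
      by (simp add: transpose_in_doubly_substochastic_sum)
    then show "B \<in> ?t ` doubly_substochastic_sum s"
      by (intro image_eqI[of _ _ "?t B"]) (simp_all add: transpose_transpose)
  qed (auto simp: transpose_in_doubly_substochastic_sum)
  ultimately show ?thesis
    using face_of_linear_image[of ?t "{A}" "doubly_substochastic_sum s"]
    by (simp add: face_of_singleton)
qed

theorem theorem4p12:
  fixes A :: "real ^ 'n ^ 'n" and s :: real
  assumes "0 \<le> s" and "s \<le> real CARD('n)"
    and "A \<in> doubly_substochastic_sum s"
    and "(\<exists>i k. i \<noteq> k \<and> 0 < row_sum A i \<and> row_sum A i < 1 \<and> 0 < row_sum A k \<and> row_sum A k < 1)
       \<or> (\<exists>j l. j \<noteq> l \<and> 0 < col_sum A j \<and> col_sum A j < 1 \<and> 0 < col_sum A l \<and> col_sum A l < 1)"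
  shows "\<not> A extreme_point_of (doubly_substochastic_sum s :: (real ^ 'n ^ 'n) set)"
  using assms(4)
proof
  assume "\<exists>i k. i \<noteq> k \<and> 0 < row_sum A i \<and> row_sum A i < 1 \<and> 0 < row_sum A k \<and> row_sum A k < 1"
  then show ?thesis
    using not_extreme_point_if_two_fractional_rows[OF assms(3)] by blast
next
  have "col_sum A j = row_sum (transpose A) j" for j
    by (simp add: col_sum_def row_sum_def transpose_def)
  moreover assume "\<exists>j l. j \<noteq> l \<and> 0 < col_sum A j \<and> col_sum A j < 1 \<and> 0 < col_sum A l \<and> col_sum A l < 1"
  moreover have "transpose A \<in> doubly_substochastic_sum s"
    using assms(3) by (simp add: transpose_in_doubly_substochastic_sum)
  ultimately have "\<not> transpose A extreme_point_of doubly_substochastic_sum s"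
    using not_extreme_point_if_two_fractional_rows by metis
  then show ?thesis
    by (simp add: extreme_point_of_doubly_substochastic_sum_transpose)
qed

end
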